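(* If $k\geq\ell\geq 3$ are integers, then $p''(\mathrm{Id}_\ell + \mathrm{Rev}_k) = 1/(\ell-1)^{k-1}$. In particular, for every integer $m\geq 2$, $p''(\mathrm{Id}_{m+1}+\mathrm{Rev}_{m+1}) = 1/m^m$.
   Context: $\mathfrak{S}_n$ is the set of permutations of $[n]$. For $\{i_1<\cdots<i_m\}\subset[n]$ and $\sigma\in\mathfrak{S}_n$, $\sigma[\{i_1,\ldots,i_m\}]$ is the unique $\tau\in\mathfrak{S}_m$ with $\sigma(i_j)<\sigma(i_k)\iff\tau(j)<\tau(k)$. For $\tau\in\mathfrak{S}_m$, $\sigma\in\mathfrak{S}_n$, $p(\tau,\sigma)$ is $\binom{n}{m}^{-1}$ times the number of $m$-subsets $A\subset[n]$ with $\sigma[A]=\tau$ if $m\le n$, and $0$ if $m>n$; this is extended linearly to formal real linear combinations of permutations in the first argument. $\mathrm{Id}_n=(12\cdots n)$ and $\mathrm{Rev}_n=(n(n-1)\cdots1)$. A permutation is layered if it is a concatenation of decreasing runs of consecutive values with all values of each run smaller than all values of later runs. For a formal linear combination $f$ of permutations, $p''_N(f)=\min\{p(f,\sigma):\sigma\in\mathfrak{S}_N\text{ layered}\}$ and $p''(f)=\lim_{N\to\infty}p''_N(f)$. *)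

theory Defs
  imports Complex_Main "HOL-Combinatorics.Multiset_Permutations" "HOL-Library.Poly_Mapping"
begin

text \<open>
  A permutation of \<open>{1..n}\<close> is given in one-line notation, as a member of
  \<^term>\<open>permutations_of_set {1..n::nat}\<close>: a list of length \<open>n\<close> with values in \<open>{1..n}\<close>.
  List positions are counted from \<open>0\<close>, so \<open>\<sigma>(i)\<close> is \<open>\<sigma> ! (i - 1)\<close> and the
  \<open>m\<close>-subsets of \<open>{1..n}\<close> become \<open>m\<close>-subsets of \<open>{..<n}\<close>.
\<close>

type_synonym perm_list = "nat list"

definition Id_perm :: "nat \<Rightarrow> perm_list" where
  "Id_perm n = [1..<Suc n]"

definition Rev_perm :: "nat \<Rightarrow> perm_list" where
  "Rev_perm n = rev [1..<Suc n]"

text \<open>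
  For a set \<open>A\<close> of positions, \<^term>\<open>nths \<sigma> A ! j\<close> is the value of \<open>\<sigma>\<close> at the \<open>j\<close>-th smallest
  element of \<open>A\<close>.
\<close>

definition pattern_at :: "perm_list \<Rightarrow> nat set \<Rightarrow> perm_list" where
  "pattern_at \<sigma> A = (THE \<tau>. \<tau> \<in> permutations_of_set {1..card A} \<and>
     (\<forall>j<card A. \<forall>k<card A. nths \<sigma> A ! j < nths \<sigma> A ! k \<longleftrightarrow> \<tau> ! j < \<tau> ! k))"

definition pattern_density :: "perm_list \<Rightarrow> perm_list \<Rightarrow> real" where
  "pattern_density \<tau> \<sigma> =
     (if length \<tau> \<le> length \<sigma>
      then real (card {A. A \<subseteq> {..<length \<sigma>} \<and> card A = length \<tau> \<and> pattern_at \<sigma> A = \<tau>})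
           / real (length \<sigma> choose length \<tau>)
      else 0)"

text \<open>
  Formal real linear combinations of permutations are finitely supported functions.
  A list that is not a permutation is never a pattern, so it contributes density \<open>0\<close>.
\<close>

definition comb_density :: "(perm_list \<Rightarrow>\<^sub>0 real) \<Rightarrow> perm_list \<Rightarrow> real" where
  "comb_density f \<sigma> = (\<Sum>\<tau>\<in>Poly_Mapping.keys f. Poly_Mapping.lookup f \<tau> * pattern_density \<tau> \<sigma>)"

definition formal_perm :: "perm_list \<Rightarrow> (perm_list \<Rightarrow>\<^sub>0 real)" where
  "formal_perm \<tau> = Poly_Mapping.single \<tau> 1"

definition layered :: "perm_list \<Rightarrow> bool" where
  "layered \<sigma> \<longleftrightarrow> (\<exists>runs. \<sigma> = concat runs \<and>
     (\<forall>r\<in>set runs. \<exists>a b. a < b \<and> r = rev [a..<b]) \<and>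
     sorted_wrt (\<lambda>r s. \<forall>x\<in>set r. \<forall>y\<in>set s. x < y) runs)"

definition layered_min :: "(perm_list \<Rightarrow>\<^sub>0 real) \<Rightarrow> nat \<Rightarrow> real" where
  "layered_min f N = Min {comb_density f \<sigma> |\<sigma>. \<sigma> \<in> permutations_of_set {1..N} \<and> layered \<sigma>}"

definition layered_limit :: "(perm_list \<Rightarrow>\<^sub>0 real) \<Rightarrow> real" where
  "layered_limit f = lim (layered_min f)"

end

theory Submission
  imports Defs
begin

text \<open>
  If the layers of \<open>\<sigma>\<close> have relative sizes \<open>x\<^sub>i\<close>, then up to \<open>O(1/N)\<close> the density of \<open>Id\<^sub>l\<close> plus that
  of \<open>Rev\<^sub>k\<close> is \<open>F(x) = l! e\<^sub>l(x) + \<Sum>\<^sub>i x\<^sub>i ^ k\<close>, where \<open>e\<^sub>l\<close> is the elementary symmetric function.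
  As long as there are at least \<open>l\<close> layers, merging the two smallest ones, of sizes \<open>a \<le> b\<close>, does
  not increase \<open>F\<close>: the power sum grows by at most \<open>k a b (a + b) ^ (k - 2)\<close>, while \<open>l! e\<^sub>l\<close> drops
  by at least \<open>l! a b b ^ (l - 2)\<close>, because all other layers are at least as large as \<open>b\<close>; and
  \<open>a + b \<le> 2 / l\<close>.  With at most \<open>l - 1\<close> layers the power mean inequality gives the bound, and
  \<open>l - 1\<close> layers of almost equal size attain it asymptotically.
\<close>

section \<open>An inequality for elementary symmetric functions\<close>

definition esym :: "'a set \<Rightarrow> ('a \<Rightarrow> real) \<Rightarrow> nat \<Rightarrow> real" where
  "esym I x n = (\<Sum>B | B \<subseteq> I \<and> card B = n. \<Prod>i\<in>B. x i)"

lemma subsets_insert_card_Suc: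
  assumes "finite I" "i \<notin> I"
  shows "{B. B \<subseteq> insert i I \<and> card B = Suc n} =
    {B. B \<subseteq> I \<and> card B = Suc n} \<union> insert i ` {B. B \<subseteq> I \<and> card B = n}" (is "?L = ?R")
proof (intro equalityI subsetI)
  fix B assume B: "B \<in> ?L"
  show "B \<in> ?R"
  proof (cases "i \<in> B")
    case True
    then have "B = insert i (B - {i})" "B - {i} \<subseteq> I" "card (B - {i}) = n"
      using B by auto
    then show ?thesis by blast
  qed (use B in auto)
next
  fix B assume "B \<in> ?R"
  then show "B \<in> ?L"
    using assms(2) by (auto simp: card_insert_if finite_subset[OF _ assms(1)])
qed

lemma esym_0: "finite I \<Longrightarrow> esym I x 0 = 1"
proof -
  assume "finite I"
  then have "{B. B \<subseteq> I \<and> card B = 0} = {{}}" by (auto dest: finite_subset)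
  then show ?thesis by (simp add: esym_def)
qed

lemma esym_insert:
  assumes "finite I" "i \<notin> I"
  shows "esym (insert i I) x (Suc n) = esym I x (Suc n) + x i * esym I x n"
proof -
  have fin: "finite {B. B \<subseteq> I \<and> card B = j}" for j
    using assms by simp
  have inj: "inj_on (insert i) {B. B \<subseteq> I \<and> card B = n}"
    using assms(2) by (intro inj_onI) (metis insert_ident mem_Collect_eq subsetD)
  have "esym (insert i I) x (Suc n) = esym I x (Suc n)
      + (\<Sum>B\<in>insert i ` {B. B \<subseteq> I \<and> card B = n}. \<Prod>i\<in>B. x i)"
    unfolding esym_def subsets_insert_card_Suc[OF assms]
    by (rule sum.union_disjoint) (use fin assms in auto)
  also have "(\<Sum>B\<in>insert i ` {B. B \<subseteq> I \<and> card B = n}. \<Prod>i\<in>B. x i)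
      = (\<Sum>B | B \<subseteq> I \<and> card B = n. x i * (\<Prod>i\<in>B. x i))"
    unfolding sum.reindex[OF inj] o_def
  proof (rule sum.cong[OF refl])
    fix B assume "B \<in> {B. B \<subseteq> I \<and> card B = n}"
    then have "finite B" "i \<notin> B" using assms finite_subset by auto
    then show "prod x (insert i B) = x i * prod x B" by simp
  qed
  finally show ?thesis by (simp add: esym_def sum_distrib_left)
qed

lemma esym_cong: "(\<And>i. i \<in> I \<Longrightarrow> x i = y i) \<Longrightarrow> esym I x n = esym I y n"
  unfolding esym_def by (intro sum.cong refl prod.cong) auto

lemma esym_divide: "esym I (\<lambda>i. x i / c) n = esym I x n / c ^ n"
  unfolding esym_def sum_divide_distrib by (intro sum.cong) (auto simp: prod_dividef)

lemma esym_nonneg: "(\<And>i. i \<in> I \<Longrightarrow> x i \<ge> 0) \<Longrightarrow> esym I x n \<ge> 0"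
  unfolding esym_def by (intro sum_nonneg prod_nonneg) auto

text \<open>One choice of \<open>n\<close> indices already gives a product of at least
  \<open>b ^ n\<close>, and all other products are nonnegative. It is applied to the layers that
  remain when two smallest ones are taken out.\<close>

lemma esym_ge_power:
  assumes "finite I" "n \<le> card I" "b \<ge> 0" "\<And>i. i \<in> I \<Longrightarrow> b \<le> x i"
  shows "b ^ n \<le> esym I x n"
proof -
  obtain B where B: "B \<subseteq> I" "card B = n"
    using obtain_subset_with_card_n[OF assms(2)] by blast
  have "b ^ n = (\<Prod>i\<in>B. b)" using B by simp
  also have "\<dots> \<le> (\<Prod>i\<in>B. x i)" using assms B by (intro prod_mono) auto
  also have "\<dots> \<le> esym I x n"
    unfolding esym_def
  proof (rule member_le_sum)
    show "B \<in> {B. B \<subseteq> I \<and> card B = n}" using B by simp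
    show "finite {B. B \<subseteq> I \<and> card B = n}" using assms(1) by simp
    fix C assume "C \<in> {B. B \<subseteq> I \<and> card B = n} - {B}"
    then have "C \<subseteq> I" by simp
    then show "0 \<le> prod x C"
      using order_trans[OF assms(3,4)] by (intro prod_nonneg) auto
  qed
  finally show ?thesis .
qed

section \<open>Numerical inequalities for merging two parts\<close>

lemma power_add_le:
  fixes a b :: real
  assumes "a \<ge> 0" "b \<ge> 0"
  shows "(a + b) ^ (n + 2) \<le> a ^ (n + 2) + b ^ (n + 2) + real (n + 2) * (a * b * (a + b) ^ n)"
proof (induction n)
  case 0
  show ?case by (simp add: power2_eq_square algebra_simps)
next
  case (Suc n)
  have p: "a ^ Suc n + b ^ Suc n \<le> (a + b) ^ Suc n"
    using assms
  proof (induction n)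
    case (Suc n)
    have "a ^ Suc (Suc n) + b ^ Suc (Suc n) \<le> (a + b) * (a ^ Suc n + b ^ Suc n)"
      using assms by (simp add: algebra_simps)
    also have "\<dots> \<le> (a + b) * (a + b) ^ Suc n"
      using Suc assms by (intro mult_left_mono) auto
    finally show ?case by simp
  qed simp
  have "(a + b) ^ (Suc n + 2) = (a + b) * (a + b) ^ (n + 2)" by simp
  also have "\<dots> \<le> (a + b) * (a ^ (n + 2) + b ^ (n + 2) + real (n + 2) * (a * b * (a + b) ^ n))"
    using Suc assms by (intro mult_left_mono) auto
  \<comment> \<open>Multiplying the pure powers by \<open>a + b\<close> leaves the cross term
    \<open>a * b * (a ^ Suc n + b ^ Suc n)\<close>; superadditivity \<open>p\<close> turns it into
    one more copy of \<open>a * b * (a + b) ^ Suc n\<close>, which raises the coefficient by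
    one.\<close>
  also have "\<dots> = a ^ (Suc n + 2) + b ^ (Suc n + 2) + a * b * (a ^ Suc n + b ^ Suc n)
      + real (n + 2) * (a * b * (a + b) ^ Suc n)"
    by (simp add: algebra_simps)
  also have "a * b * (a ^ Suc n + b ^ Suc n) \<le> a * b * (a + b) ^ Suc n"
    using p assms by (intro mult_left_mono) auto
  finally show ?case by (simp add: algebra_simps)
qed

text \<open>Pays for the factor \<open>2 ^ (l - 2)\<close> that arises in \<open>merge_gain\<close>
  when \<open>a + b\<close> is replaced by \<open>2 * b\<close>.\<close>

lemma power2_le_fact: "2 ^ n \<le> (fact (Suc n) :: real)"
proof (induction n)
  case (Suc n)
  have "(2::real) * 2 ^ n \<le> real (Suc (Suc n)) * fact (Suc n)"
    using Suc by (intro mult_mono) auto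
  then show ?case by (simp only: power_Suc fact_Suc of_nat_mult)
qed simp

text \<open>At \<open>j = 0\<close> there is equality, and passing from \<open>j\<close> to
  \<open>j + 1\<close> multiplies the left side by \<open>(l + j + 1) / (l + j) * (2 / l)\<close>,
  which is at most 1 for \<open>l \<ge> 3\<close>. With \<open>k = l + j\<close> this takes care of
  the excess of \<open>k\<close> over \<open>l\<close>.\<close>

lemma mult_power_le:
  fixes l j :: nat
  assumes "l \<ge> 3"
  shows "real (l + j) * (2 / real l) ^ j \<le> real l"
proof (induction j)
  case (Suc j)
  have "2 * (l + Suc j) \<le> l * (l + j)"
  proof -
    have "2 * (l + Suc j) \<le> 3 * (l + j)" using assms by simp
    also have "\<dots> \<le> l * (l + j)" using assms by (intro mult_right_mono) auto
    finally show ?thesis .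
  qed
  then have "2 * real (l + Suc j) \<le> real l * real (l + j)"
    by (metis of_nat_le_iff of_nat_mult of_nat_numeral)
  then have "real (l + Suc j) * (2 / real l) \<le> real (l + j)"
    using assms by (simp add: divide_simps mult.commute)
  then have "real (l + Suc j) * (2 / real l) * (2 / real l) ^ j \<le> real (l + j) * (2 / real l) ^ j"
    by (intro mult_right_mono) auto
  with Suc show ?case by (simp only: power_Suc mult.assoc)
qed simp

text \<open>Power mean inequality by tangent lines: Bernoulli's inequality bounds
  \<open>(m * x i) ^ k\<close> below by its tangent at \<open>x i = 1 / m\<close>, and the linear
  bounds are summed using \<open>sum x I = 1\<close>.\<close>

lemma sum_power_ge:
  fixes x :: "'a \<Rightarrow> real"
  assumes "finite I" "card I \<le> m" "m > 0" "k > 0"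
    and "\<And>i. i \<in> I \<Longrightarrow> x i \<ge> 0" "sum x I = 1"
  shows "1 / real m ^ (k - 1) \<le> (\<Sum>i\<in>I. x i ^ k)"
proof -
  \<comment> \<open>Each index contributes the constant \<open>1 - k\<close>, which is not positive,
    so having fewer than \<open>m\<close> indices only increases the sum of the tangent
    bounds.\<close>
  have "real m \<le> real (card I) * (1 - real k) + real k * real m"
  proof -
    have "real m * (real k - 1) \<ge> real (card I) * (real k - 1)"
      using assms by (intro mult_right_mono) auto
    then show ?thesis by (simp add: algebra_simps)
  qed
  also have "\<dots> = (\<Sum>i\<in>I. 1 + real k * (real m * x i - 1))"
  proof -
    have "(\<Sum>i\<in>I. 1 + real k * (real m * x i - 1)) = (\<Sum>i\<in>I. (1 - real k) + real k * real m * x i)"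
      by (intro sum.cong) (auto simp: algebra_simps)
    also have "\<dots> = real (card I) * (1 - real k) + real k * real m * sum x I"
      by (simp add: sum.distrib sum_distrib_left)
    finally show ?thesis using assms by simp
  qed
  also have "\<dots> \<le> (\<Sum>i\<in>I. (1 + (real m * x i - 1)) ^ k)"
    using assms by (intro sum_mono Bernoulli_inequality) auto
  also have "\<dots> = real m ^ k * (\<Sum>i\<in>I. x i ^ k)"
    by (simp add: power_mult_distrib sum_distrib_left)
  finally have "real m \<le> real m ^ k * (\<Sum>i\<in>I. x i ^ k)" .
  moreover have "real m ^ k = real m * real m ^ (k - 1)"
    using assms by (simp add: power_eq_if)
  ultimately show ?thesis using assms by (simp add: field_simps)
qed

text \<open>Here \<open>a\<close> and \<open>b\<close> are the two merged sizes, and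
  \<open>e\<close> stands for the elementary symmetric function of degree \<open>l - 2\<close> in
  the other layers. By \<open>power_add_le\<close> it suffices to bound
  \<open>k * (a + b) ^ (k - 2)\<close> by \<open>fact l * e\<close>.\<close>

lemma merge_gain:
  fixes a b e :: real
  assumes "3 \<le> l" "l \<le> k" "0 \<le> a" "a \<le> b" "a + b \<le> 2 / real l" "b ^ (l - 2) \<le> e"
  shows "(a + b) ^ k \<le> a ^ k + b ^ k + fact l * (a * b * e)"
proof -
  define j where "j = k - l"
  have k: "k = l + j" and b0: "b \<ge> 0" using assms by (auto simp: j_def)
  have "real k * (a + b) ^ (k - 2) = (real (l + j) * (a + b) ^ j) * (a + b) ^ (l - 2)"
    using assms k by (simp flip: power_add add: add.commute)
  \<comment> \<open>The exponent \<open>k - 2\<close> is split as \<open>j + (l - 2)\<close>: the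
    first \<open>j\<close> factors are bounded by \<open>2 / l\<close>, to be cancelled by
    \<open>mult_power_le\<close>, and the other \<open>l - 2\<close> factors by
    \<open>2 * b\<close>, to be compared with \<open>e\<close>.\<close>
  also have "\<dots> \<le> (real (l + j) * (2 / real l) ^ j) * (2 * b) ^ (l - 2)"
    using assms by (intro mult_mono power_mono) auto
  also have "\<dots> \<le> real l * (2 * b) ^ (l - 2)"
    using mult_power_le[OF assms(1), of j] b0 by (intro mult_right_mono) auto
  also have "\<dots> = real l * 2 ^ (l - 2) * b ^ (l - 2)"
    by (simp add: power_mult_distrib)
  also have "\<dots> \<le> real l * fact (l - 1) * e"
  proof -
    have "Suc (l - 2) = l - 1" using assms by simp
    then show ?thesis
      using power2_le_fact[of "l - 2"] assms b0 by (intro mult_mono) auto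
  qed
  also have "\<dots> = fact l * e" using assms by (simp add: fact_reduce[of l])
  finally have "a * b * (real k * (a + b) ^ (k - 2)) \<le> a * b * (fact l * e)"
    using assms by (intro mult_left_mono) auto
  moreover have "(a + b) ^ k \<le> a ^ k + b ^ k + real k * (a * b * (a + b) ^ (k - 2))"
  proof -
    have "k - 2 + 2 = k" using assms by simp
    then show ?thesis using power_add_le[of a b "k - 2"] assms(3) b0 by metis
  qed
  ultimately show ?thesis by (simp add: algebra_simps)
qed

lemma two_smallest:
  fixes x :: "'a \<Rightarrow> real"
  assumes "finite I" "2 \<le> card I"
  obtains i j where "i \<in> I" "j \<in> I" "i \<noteq> j" "x j \<le> x i"
    "\<And>h. h \<in> I - {i, j} \<Longrightarrow> x i \<le> x h"
proof -
  have "I \<noteq> {}" using assms by auto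
  then obtain j where j: "j \<in> I" "\<And>h. h \<in> I \<Longrightarrow> x j \<le> x h"
    using ex_is_arg_min_if_finite[OF assms(1), of x]
    by (metis is_arg_min_linorder)
  have "I - {j} \<noteq> {}" using assms j by (metis Diff_eq_empty_iff card_1_singleton_iff card_mono finite.emptyI finite_insert not_less_eq_eq numeral_2_eq_2)
  then obtain i where i: "i \<in> I - {j}" "\<And>h. h \<in> I - {j} \<Longrightarrow> x i \<le> x h"
    using ex_is_arg_min_if_finite[of "I - {j}" x] assms
    by (metis is_arg_min_linorder finite_Diff)
  show ?thesis using i j by (intro that[of i j]) auto
qed

text \<open>Induction on the number of indices. Below \<open>l\<close> indices the power sum alone
  suffices; otherwise two smallest weights are merged and the induction hypothesis applies to the
  merged family, which is again nonnegative with total 1.\<close>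

lemma esym_power_sum_ge:
  fixes x :: "'a \<Rightarrow> real"
  assumes "3 \<le> l" "l \<le> k" "finite I"
    and "\<And>i. i \<in> I \<Longrightarrow> x i \<ge> 0" "sum x I = 1"
  shows "1 / (real l - 1) ^ (k - 1) \<le> fact l * esym I x l + (\<Sum>i\<in>I. x i ^ k)"
  using assms(3-5)
proof (induction "card I" arbitrary: I x rule: less_induct)
  case less
  show ?case
  proof (cases "card I < l")
    case True
    then have "1 / real (l - 1) ^ (k - 1) \<le> (\<Sum>i\<in>I. x i ^ k)"
      using assms less.prems by (intro sum_power_ge) auto
    moreover have "0 \<le> esym I x l" by (rule esym_nonneg) (rule less.prems)
    ultimately show ?thesis using assms by (simp add: of_nat_diff add_increasing)
  next
    case False
    then have "2 \<le> card I" using assms by simp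
    then obtain i j where ij: "i \<in> I" "j \<in> I" "i \<noteq> j" "x j \<le> x i"
        and min: "\<And>h. h \<in> I - {i, j} \<Longrightarrow> x i \<le> x h"
      using two_smallest[OF less.prems(1)] by metis
    \<comment> \<open>The merged weight is placed at index \<open>i\<close>, and index
      \<open>j\<close> is dropped; \<open>J\<close> collects the untouched indices.\<close>
    define J where "J = I - {i, j}"
    define y where "y = x(i := x i + x j)"
    have J: "finite J" "i \<notin> J" "j \<notin> J" "i \<notin> insert j J" "I = insert i (insert j J)"
      using ij less.prems by (auto simp: J_def)
    have cI: "card I = card J + 2" using J by simp
    have pos: "0 \<le> x i" "0 \<le> x j" using ij less.prems by auto
    have eq: "y h = x h" if "h \<in> J" for h using that J by (auto simp: y_def)
    have sumJ: "sum x I = x i + x j + sum x J" using J by simp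
    obtain l' where l': "l = Suc (Suc l')"
      using assms(1) that[of "l - 2"] by simp
    \<comment> \<open>Sorting the products by how many of \<open>i\<close> and \<open>j\<close> they
      contain: those with at most one of the two survive the merge, and those with both account for
      the difference in \<open>e\<close>.\<close>
    have "esym I x l = esym J x l + (x i + x j) * esym J x (l - 1) + x i * x j * esym J x (l - 2)"
      unfolding l' J(5) using J by (simp add: esym_insert algebra_simps)
    moreover have "esym (insert i J) y l = esym J x l + (x i + x j) * esym J x (l - 1)"
      unfolding l' using J esym_cong[of J y x, OF eq]
      by (simp add: esym_insert) (simp add: y_def)
    ultimately have e: "esym I x l = esym (insert i J) y l + x j * x i * esym J x (l - 2)"
      by simp
    have p: "(\<Sum>h\<in>I. x h ^ k) = (\<Sum>h\<in>insert i J. y h ^ k) - (x i + x j) ^ k + x i ^ k + x j ^ k"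
    proof -
      have "(\<Sum>h\<in>J. y h ^ k) = (\<Sum>h\<in>J. x h ^ k)" using eq by simp
      then show ?thesis using J by (simp add: y_def)
    qed
    have "(x j + x i) ^ k \<le> x j ^ k + x i ^ k + fact l * (x j * x i * esym J x (l - 2))"
    proof (rule merge_gain)
      \<comment> \<open>At least \<open>l - 2\<close> other weights are each at least
        \<open>x i\<close>, hence at least the mean of \<open>x i\<close> and \<open>x j\<close>. So
        the total 1 is at least \<open>l\<close> times this mean, which gives the bound
        \<open>2 / l\<close>.\<close>
      have "real (card J) * x i \<le> sum x J"
        using min by (intro sum_bounded_below) (auto simp: J_def)
      moreover have "(real l - 2) * ((x i + x j) / 2) \<le> real (card J) * x i"
        using False cI ij pos assms(1) by (intro mult_mono) auto
      ultimately have "(x i + x j) * real l \<le> 2"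
        using sumJ less.prems by (simp add: algebra_simps)
      then show "x j + x i \<le> 2 / real l" using assms by (simp add: field_simps)
      show "x i ^ (l - 2) \<le> esym J x (l - 2)"
        using J(1) False cI pos min by (intro esym_ge_power) (auto simp: J_def)
    qed (use assms pos ij in auto)
    moreover have "1 / (real l - 1) ^ (k - 1) \<le> fact l * esym (insert i J) y l + (\<Sum>h\<in>insert i J. y h ^ k)"
    proof (rule less.hyps)
      show "card (insert i J) < card I" using J(1,2) cI by simp
      show "finite (insert i J)" using J(1) by simp
      show "0 \<le> y h" if "h \<in> insert i J" for h
        using that pos less.prems(2)[of h] J(5) by (auto simp: y_def)
      show "sum y (insert i J) = 1"
      proof -
        have "sum y J = sum x J" using eq by simp
        then show ?thesis using J sumJ less.prems by (simp add: y_def)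
      qed
    qed
    ultimately show ?thesis unfolding e p by (simp add: algebra_simps)
  qed
qed

section \<open>Patterns\<close>

lemma perm_nth_bij:
  assumes "\<tau> \<in> permutations_of_set {1..n}"
  shows "length \<tau> = n" "bij_betw ((!) \<tau>) {..<n} {1..n}"
proof -
  have \<tau>: "set \<tau> = {1..n}" "distinct \<tau>"
    using assms by (auto simp: permutations_of_set_def)
  then show l: "length \<tau> = n" using distinct_card by fastforce
  show "bij_betw ((!) \<tau>) {..<n} {1..n}"
    using bij_betw_nth[OF \<tau>(2), of "{..<n}" "{1..n}"] \<tau> l by simp
qed

text \<open>The values not exceeding \<open>\<tau> ! j\<close> are
  \<open>1, ..., \<tau> ! j\<close>, each taken once. Hence the order relation between entries
  determines the permutation, which yields uniqueness of patterns in
  \<open>perm_eqI\<close>.\<close>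

lemma perm_nth_eq_rank:
  assumes "\<tau> \<in> permutations_of_set {1..n}" "j < n"
  shows "\<tau> ! j = card {k. k < n \<and> \<tau> ! k \<le> \<tau> ! j}"
proof -
  note b = perm_nth_bij[OF assms(1)]
  have "(!) \<tau> ` {k. k < n \<and> \<tau> ! k \<le> \<tau> ! j} = {1..\<tau> ! j}"
  proof -
    have im: "(!) \<tau> ` {..<n} = {1..n}" using b by (auto simp: bij_betw_def)
    have "\<tau> ! j \<le> n" using im assms(2) by (metis atLeastAtMost_iff imageI lessThan_iff)
    show ?thesis
    proof (intro equalityI subsetI)
      fix v assume "v \<in> {1..\<tau> ! j}"
      then have "v \<in> (!) \<tau> ` {..<n}" using im \<open>\<tau> ! j \<le> n\<close> by auto
      then show "v \<in> (!) \<tau> ` {k. k < n \<and> \<tau> ! k \<le> \<tau> ! j}"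
        using \<open>v \<in> {1..\<tau> ! j}\<close> by auto
    next
      fix v assume "v \<in> (!) \<tau> ` {k. k < n \<and> \<tau> ! k \<le> \<tau> ! j}"
      then have "v \<in> (!) \<tau> ` {..<n}" "v \<le> \<tau> ! j" by auto
      then show "v \<in> {1..\<tau> ! j}" unfolding im by simp
    qed
  qed
  moreover have "inj_on ((!) \<tau>) {k. k < n \<and> \<tau> ! k \<le> \<tau> ! j}"
    using b(2) by (auto simp: bij_betw_def inj_on_def)
  ultimately show ?thesis by (metis card_image card_atLeastAtMost diff_Suc_1)
qed

lemma perm_eqI:
  assumes "\<tau> \<in> permutations_of_set {1..n}" "\<rho> \<in> permutations_of_set {1..n}"
    and "\<And>j k. j < n \<Longrightarrow> k < n \<Longrightarrow> \<tau> ! j < \<tau> ! k \<longleftrightarrow> \<rho> ! j < \<rho> ! k"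
  shows "\<tau> = \<rho>"
proof (rule nth_equalityI)
  show "length \<tau> = length \<rho>" using assms perm_nth_bij(1) by metis
  fix j assume "j < length \<tau>"
  then have j: "j < n" using assms perm_nth_bij(1) by metis
  then have "{k. k < n \<and> \<tau> ! k \<le> \<tau> ! j} = {k. k < n \<and> \<rho> ! k \<le> \<rho> ! j}"
    using assms(3) by (auto simp flip: not_less)
  then show "\<tau> ! j = \<rho> ! j"
    using perm_nth_eq_rank[OF assms(1) j] perm_nth_eq_rank[OF assms(2) j] by simp
qed

text \<open>Existence for the definite description in \<open>pattern_at\<close>: every entry is
  replaced by its rank.\<close>

lemma ex_standardization:
  fixes xs :: "'a :: linorder list"
  assumes "distinct xs"
  shows "\<exists>\<tau>\<in>permutations_of_set {1..length xs}.
    \<forall>j<length xs. \<forall>k<length xs. xs ! j < xs ! k \<longleftrightarrow> \<tau> ! j < \<tau> ! k"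
proof -
  define n where "n = length xs"
  \<comment> \<open>The non-strict comparison puts \<open>j\<close> itself into \<open>R j\<close>,
    so the ranks run from 1 to \<open>n\<close>.\<close>
  define R where "R j = {k. k < n \<and> xs ! k \<le> xs ! j}" for j
  define \<tau> where "\<tau> = map (\<lambda>j. card (R j)) [0..<n]"
  have fin: "finite (R j)" for j by (simp add: R_def)
  have less: "card (R j) < card (R k)" if "j < n" "k < n" "xs ! j < xs ! k" for j k
  proof (rule psubset_card_mono[OF fin])
    have "k \<in> R k" "k \<notin> R j" using that by (simp_all add: R_def)
    moreover have "R j \<subseteq> R k" unfolding R_def using that(3) by fastforce
    ultimately show "R j \<subset> R k" by blast
  qed
  have iff: "xs ! j < xs ! k \<longleftrightarrow> card (R j) < card (R k)" if "j < n" "k < n" for j k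
    using less that assms
    by (metis linorder_neqE less_asym n_def nth_eq_iff_index_eq less_irrefl)
  have "inj_on (\<lambda>j. card (R j)) {0..<n}"
  proof (rule inj_onI)
    fix j k assume "j \<in> {0..<n}" "k \<in> {0..<n}" "card (R j) = card (R k)"
    then show "j = k" using less[of j k] less[of k j] assms
      by (cases "xs ! j" "xs ! k" rule: linorder_cases) (auto simp: n_def nth_eq_iff_index_eq)
  qed
  then have d: "distinct \<tau>" by (simp add: \<tau>_def distinct_map)
  have "card (R j) \<in> {1..n}" if "j < n" for j
  proof -
    have "card (R j) \<le> card {..<n}" by (intro card_mono) (auto simp: R_def)
    moreover have "0 < card (R j)" using that fin by (subst card_gt_0_iff) (auto simp: R_def)
    ultimately show ?thesis by simp
  qed
  then have "set \<tau> \<subseteq> {1..n}" by (auto simp: \<tau>_def)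
  moreover have "card (set \<tau>) = card {1..n}" using distinct_card[OF d] by (simp add: \<tau>_def)
  ultimately have "set \<tau> = {1..n}" by (intro card_subset_eq) auto
  then show ?thesis
    using d iff by (intro bexI[of _ \<tau>]) (auto simp: n_def[symmetric] \<tau>_def permutations_of_set_def)
qed

section \<open>From patterns to order conditions and sets of values\<close>

lemma length_nths_subset: "A \<subseteq> {..<length xs} \<Longrightarrow> length (nths xs A) = card A"
  unfolding length_nths by (rule arg_cong[of _ _ card]) auto

text \<open>Eliminates the definite description: a pattern exists by standardization and is unique
  by \<open>perm_eqI\<close>, so satisfying the order condition is the same as being the
  pattern.\<close>

lemma pattern_at_eq_iff:
  assumes "distinct \<sigma>" "A \<subseteq> {..<length \<sigma>}" "\<tau> \<in> permutations_of_set {1..card A}"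
  shows "pattern_at \<sigma> A = \<tau> \<longleftrightarrow>
    (\<forall>j<card A. \<forall>k<card A. nths \<sigma> A ! j < nths \<sigma> A ! k \<longleftrightarrow> \<tau> ! j < \<tau> ! k)" (is "_ \<longleftrightarrow> ?P \<tau>")
proof -
  have len: "length (nths \<sigma> A) = card A" by (rule length_nths_subset) fact
  obtain \<rho> where \<rho>: "\<rho> \<in> permutations_of_set {1..card A}" "?P \<rho>"
    using ex_standardization[of "nths \<sigma> A"] assms(1) unfolding len by (auto simp: distinct_nthsI)
  have uniq: "\<rho>' = \<rho>" if "\<rho>' \<in> permutations_of_set {1..card A}" "?P \<rho>'" for \<rho>'
    using that \<rho> by (intro perm_eqI[where n = "card A"]) blast+
  have "pattern_at \<sigma> A = \<rho>"
    unfolding pattern_at_def using \<rho> uniq by (intro the_equality) blast+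
  then show ?thesis using \<rho> uniq assms(3) by blast
qed

lemma Id_perm_permutation: "Id_perm n \<in> permutations_of_set {1..n}"
  by (auto simp: Id_perm_def permutations_of_set_def simp del: upt_Suc)

lemma Rev_perm_permutation: "Rev_perm n \<in> permutations_of_set {1..n}"
  by (auto simp: Rev_perm_def permutations_of_set_def simp del: upt_Suc)

lemma pattern_at_eq_Id:
  assumes "distinct \<sigma>" "A \<subseteq> {..<length \<sigma>}" "card A = n"
  shows "pattern_at \<sigma> A = Id_perm n \<longleftrightarrow> sorted_wrt (<) (nths \<sigma> A)"
proof -
  have len: "length (nths \<sigma> A) = n" using length_nths_subset assms by metis
  have "pattern_at \<sigma> A = Id_perm n \<longleftrightarrow> (\<forall>j<n. \<forall>k<n. nths \<sigma> A ! j < nths \<sigma> A ! k \<longleftrightarrow> j < k)"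
    using pattern_at_eq_iff[OF assms(1,2), of "Id_perm n"] Id_perm_permutation[of n] assms(3)
    by (simp add: Id_perm_def del: upt_Suc)
  also have "\<dots> \<longleftrightarrow> sorted_wrt (<) (nths \<sigma> A)"
    unfolding sorted_wrt_iff_nth_less len
  proof
    assume *: "\<forall>i j. i < j \<longrightarrow> j < n \<longrightarrow> nths \<sigma> A ! i < nths \<sigma> A ! j"
    have "nths \<sigma> A ! j < nths \<sigma> A ! k \<longleftrightarrow> j < k" if "j < n" "k < n" for j k
      using *[rule_format, of j k] *[rule_format, of k j] that
      by (cases j k rule: linorder_cases) auto
    then show "\<forall>j<n. \<forall>k<n. nths \<sigma> A ! j < nths \<sigma> A ! k \<longleftrightarrow> j < k" by blast
  qed auto
  finally show ?thesis .
qed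

lemma pattern_at_eq_Rev:
  assumes "distinct \<sigma>" "A \<subseteq> {..<length \<sigma>}" "card A = n"
  shows "pattern_at \<sigma> A = Rev_perm n \<longleftrightarrow> sorted_wrt (>) (nths \<sigma> A)"
proof -
  have len: "length (nths \<sigma> A) = n" using length_nths_subset assms by metis
  have "Rev_perm n ! j < Rev_perm n ! k \<longleftrightarrow> k < j" if "j < n" "k < n" for j k
    using that by (auto simp: Rev_perm_def rev_nth simp del: upt_Suc)
  then have "pattern_at \<sigma> A = Rev_perm n \<longleftrightarrow> (\<forall>j<n. \<forall>k<n. nths \<sigma> A ! j < nths \<sigma> A ! k \<longleftrightarrow> k < j)"
    using pattern_at_eq_iff[OF assms(1,2), of "Rev_perm n"] Rev_perm_permutation[of n] assms(3)
    by simp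
  also have "\<dots> \<longleftrightarrow> sorted_wrt (>) (nths \<sigma> A)"
    unfolding sorted_wrt_iff_nth_less len
  proof
    assume *: "\<forall>i j. i < j \<longrightarrow> j < n \<longrightarrow> nths \<sigma> A ! j < nths \<sigma> A ! i"
    have "nths \<sigma> A ! j < nths \<sigma> A ! k \<longleftrightarrow> k < j" if "j < n" "k < n" for j k
      using *[rule_format, of j k] *[rule_format, of k j] that
      by (cases j k rule: linorder_cases) auto
    then show "\<forall>j<n. \<forall>k<n. nths \<sigma> A ! j < nths \<sigma> A ! k \<longleftrightarrow> k < j" by blast
  qed auto
  finally show ?thesis .
qed

lemma set_nths_image: "A \<subseteq> {..<length xs} \<Longrightarrow> set (nths xs A) = (!) xs ` A"
  unfolding set_nths by auto

text \<open>Since entries are distinct, sending a set of positions to its set of values is a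
  bijection. This moves the counting from positions to values, where layers are plain disjoint
  sets.\<close>

lemma card_position_sets:
  assumes "distinct \<sigma>"
  shows "card {A. A \<subseteq> {..<length \<sigma>} \<and> card A = n \<and> P (set (nths \<sigma> A))}
    = card {V. V \<subseteq> set \<sigma> \<and> card V = n \<and> P V}"
proof -
  have inj: "inj_on ((!) \<sigma>) {..<length \<sigma>}"
    using assms by (simp add: inj_on_nth)
  have im: "(!) \<sigma> ` {..<length \<sigma>} = set \<sigma>"
    by (auto simp: set_conv_nth)
  have "(`) ((!) \<sigma>) ` {A. A \<subseteq> {..<length \<sigma>} \<and> card A = n \<and> P (set (nths \<sigma> A))}
      = {V. V \<subseteq> set \<sigma> \<and> card V = n \<and> P V}" (is "?f ` ?L = ?R")
  proof (intro equalityI subsetI)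
    fix V assume "V \<in> ?f ` ?L"
    then obtain A where A: "A \<in> ?L" "V = (!) \<sigma> ` A" by auto
    then have "card V = card A" using inj by (auto intro!: card_image inj_on_subset[OF inj])
    then show "V \<in> ?R" using A im by (auto simp: set_nths_image)
  next
    fix V assume V: "V \<in> ?R"
    then obtain A where A: "A \<subseteq> {..<length \<sigma>}" "V = (!) \<sigma> ` A"
      using im by (metis (no_types, lifting) mem_Collect_eq subset_imageE)
    moreover have "card V = card A" using A(2) by (auto intro!: card_image inj_on_subset[OF inj] A(1))
    ultimately show "V \<in> ?f ` ?L" using V by (auto simp: set_nths_image)
  qed
  moreover have "card (?f ` ?L) = card ?L"
    by (intro card_image inj_on_subset[OF inj_on_image_Pow[OF inj]]) auto
  ultimately show ?thesis by simp
qed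

section \<open>Layers\<close>

text \<open>Retains only order information about a decomposition into runs. Unlike being a
  permutation of \<open>{1..n}\<close>, it passes to the tail of the list of runs, which permits
  induction on that list.\<close>

definition runs_of :: "nat list \<Rightarrow> nat list list \<Rightarrow> bool" where
  "runs_of \<sigma> runs \<longleftrightarrow> \<sigma> = concat runs \<and>
     (\<forall>r\<in>set runs. r \<noteq> [] \<and> sorted_wrt (>) r) \<and>
     sorted_wrt (\<lambda>r s. \<forall>x\<in>set r. \<forall>y\<in>set s. x < y) runs"

lemma runs_of_Nil: "runs_of \<sigma> [] \<longleftrightarrow> \<sigma> = []"
  by (simp add: runs_of_def)

lemma runs_of_Cons: "runs_of \<sigma> (r # runs) \<longleftrightarrow>
    (\<exists>\<rho>. \<sigma> = r @ \<rho> \<and> runs_of \<rho> runs \<and> r \<noteq> [] \<and> sorted_wrt (>) r \<and> (\<forall>x\<in>set r. \<forall>y\<in>set \<rho>. x < y))"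
  by (auto simp: runs_of_def)

lemma sorted_wrt_nths: "sorted_wrt P xs \<Longrightarrow> sorted_wrt P (nths xs A)"
  by (induction xs arbitrary: A) (auto simp: nths_Cons dest: in_set_nthsD)

lemma card_set_le_1_if_sorted_both:
  "sorted_wrt (>) (xs :: nat list) \<Longrightarrow> sorted_wrt (<) xs \<longleftrightarrow> card (set xs) \<le> 1"
proof (cases xs)
  case (Cons x ys)
  assume s: "sorted_wrt (>) xs"
  show ?thesis
  proof (cases ys)
    case (Cons y zs)
    have "card (set xs) \<ge> card {x, y}" using \<open>xs = _\<close> Cons by (intro card_mono) auto
    then show ?thesis using s \<open>xs = _\<close> Cons by auto
  qed (use \<open>xs = _\<close> in auto)
qed simp

text \<open>Two entries of the same run are decreasing and entries of different runs are increasing,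
  so an increasing selection meets each run at most once.\<close>

lemma increasing_iff_transversal:
  assumes "runs_of \<sigma> runs"
  shows "sorted_wrt (<) (nths \<sigma> A) \<longleftrightarrow> (\<forall>D\<in>set ` set runs. card (set (nths \<sigma> A) \<inter> D) \<le> 1)"
  using assms
proof (induction runs arbitrary: \<sigma> A)
  case Nil
  then show ?case by (simp add: runs_of_Nil)
next
  case (Cons r runs)
  then obtain \<rho> where \<rho>: "\<sigma> = r @ \<rho>" "runs_of \<rho> runs" "sorted_wrt (>) r"
      "\<forall>x\<in>set r. \<forall>y\<in>set \<rho>. x < y" unfolding runs_of_Cons by blast
  define xs ys where "xs = nths r A" and "ys = nths \<rho> {j. j + length r \<in> A}"
  have n: "nths \<sigma> A = xs @ ys" by (simp add: \<rho> nths_append xs_def ys_def)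
  have sub: "set xs \<subseteq> set r" "set ys \<subseteq> set \<rho>" by (auto simp: xs_def ys_def dest: in_set_nthsD)
  have less: "\<forall>x\<in>set r. \<forall>y\<in>set \<rho>. x < y" by (rule \<rho>)
  then have disj: "set r \<inter> set \<rho> = {}" by auto
  have "set (nths \<sigma> A) \<inter> set r = set xs" using sub disj by (auto simp: n)
  moreover have "set (nths \<sigma> A) \<inter> set s = set ys \<inter> set s" if "s \<in> set runs" for s
  proof -
    have "set s \<subseteq> set \<rho>" using that \<rho>(2) by (auto simp: runs_of_def)
    then show ?thesis using sub disj by (auto simp: n)
  qed
  moreover have "sorted_wrt (<) xs \<longleftrightarrow> card (set xs) \<le> 1"
    unfolding xs_def using \<rho>(3) by (intro card_set_le_1_if_sorted_both sorted_wrt_nths)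
  moreover have "sorted_wrt (<) (nths \<sigma> A) \<longleftrightarrow> sorted_wrt (<) xs \<and> sorted_wrt (<) ys"
    using less sub by (auto simp: n sorted_wrt_append)
  moreover have "sorted_wrt (<) ys \<longleftrightarrow> (\<forall>D\<in>set ` set runs. card (set ys \<inter> D) \<le> 1)"
    unfolding ys_def by (rule Cons.IH) (rule \<rho>(2))
  ultimately show ?case by simp
qed

text \<open>Entries from different runs would form an ascent, so a decreasing selection stays inside
  one run. Nonemptiness excludes the empty selection from an empty list of runs, where no
  \<open>D\<close> exists.\<close>

lemma decreasing_iff_monochromatic:
  assumes "runs_of \<sigma> runs" "nths \<sigma> A \<noteq> []"
  shows "sorted_wrt (>) (nths \<sigma> A) \<longleftrightarrow> (\<exists>D\<in>set ` set runs. set (nths \<sigma> A) \<subseteq> D)"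
  using assms
proof (induction runs arbitrary: \<sigma> A)
  case Nil
  then show ?case by (simp add: runs_of_Nil)
next
  case (Cons r runs)
  then obtain \<rho> where \<rho>: "\<sigma> = r @ \<rho>" "runs_of \<rho> runs" "sorted_wrt (>) r"
      "\<forall>x\<in>set r. \<forall>y\<in>set \<rho>. x < y" unfolding runs_of_Cons by blast
  define xs ys where "xs = nths r A" and "ys = nths \<rho> {j. j + length r \<in> A}"
  have n: "nths \<sigma> A = xs @ ys" by (simp add: \<rho> nths_append xs_def ys_def)
  have sub: "set xs \<subseteq> set r" "set ys \<subseteq> set \<rho>" by (auto simp: xs_def ys_def dest: in_set_nthsD)
  have less: "\<And>x y. x \<in> set r \<Longrightarrow> y \<in> set \<rho> \<Longrightarrow> x < y" using \<rho> by blast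
  then have disj: "set r \<inter> set \<rho> = {}" by auto
  have runs: "set s \<subseteq> set \<rho>" if "s \<in> set runs" for s
    using that \<rho>(2) by (auto simp: runs_of_def)
  have sx: "sorted_wrt (>) xs" unfolding xs_def using \<rho>(3) by (rule sorted_wrt_nths)
  have IH: "sorted_wrt (>) ys \<longleftrightarrow> (\<exists>D\<in>set ` set runs. set ys \<subseteq> D)" if "ys \<noteq> []"
    using Cons.IH[OF \<rho>(2)] that unfolding ys_def by blast
  consider "ys = []" | "xs = []" "ys \<noteq> []" | "xs \<noteq> []" "ys \<noteq> []" by blast
  then show ?case
  proof cases
    case 1
    then show ?thesis using sx sub by (simp add: n)
  next
    case 2
    then have "\<not> set ys \<subseteq> set r" using sub disj by (cases ys) auto
    then show ?thesis using 2 IH by (simp add: n)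
  next
    case 3
    then obtain x y where xy: "x \<in> set xs" "y \<in> set ys" by (meson list.set_sel(1))
    then have "x < y" using less sub by blast
    then have "\<not> sorted_wrt (>) (xs @ ys)"
      using xy unfolding sorted_wrt_append by (meson less_asym)
    moreover have "\<not> set (xs @ ys) \<subseteq> set r" using xy sub disj by auto
    moreover have "\<not> set (xs @ ys) \<subseteq> set s" if "s \<in> set runs" for s
      using xy(1) sub(1) disj runs[OF that] by auto
    ultimately show ?thesis by (simp add: n)
  qed
qed

lemma layered_runs:
  assumes "layered \<sigma>"
  obtains runs where "runs_of \<sigma> runs"
proof -
  from assms obtain runs where "\<sigma> = concat runs" "\<forall>r\<in>set runs. \<exists>a b. a < b \<and> r = rev [a..<b]"
      "sorted_wrt (\<lambda>r s. \<forall>x\<in>set r. \<forall>y\<in>set s. x < y) runs"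
    unfolding layered_def by blast
  moreover have "sorted_wrt (>) (rev [a..<b])" for a b :: nat
    by (simp add: sorted_wrt_rev)
  ultimately have "runs_of \<sigma> runs" unfolding runs_of_def by fastforce
  then show ?thesis by (rule that)
qed

lemma runs_of_partition:
  assumes "runs_of \<sigma> runs"
  shows "disjoint (set ` set runs)" "\<Union>(set ` set runs) = set \<sigma>"
proof -
  show "\<Union>(set ` set runs) = set \<sigma>" using assms by (simp add: runs_of_def)
  show "disjoint (set ` set runs)" using assms
  proof (induction runs arbitrary: \<sigma>)
    case (Cons r runs)
    then obtain \<rho> where \<rho>: "runs_of \<rho> runs" "\<forall>x\<in>set r. \<forall>y\<in>set \<rho>. x < y"
      unfolding runs_of_Cons by blast
    have "set s \<inter> set r = {}" if "s \<in> set runs" for s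
      using that \<rho> by (fastforce simp: runs_of_def)
    then show ?case using Cons.IH[OF \<rho>(1)] by (auto simp: pairwise_insert disjnt_def)
  qed simp
qed

section \<open>Densities as counts of sets of values\<close>

lemma pattern_density_Id:
  assumes "distinct \<sigma>" "runs_of \<sigma> runs" "n \<le> length \<sigma>"
  shows "pattern_density (Id_perm n) \<sigma> =
    real (card {V. V \<subseteq> set \<sigma> \<and> card V = n \<and> (\<forall>D\<in>set ` set runs. card (V \<inter> D) \<le> 1)})
      / real (length \<sigma> choose n)"
proof -
  have len: "length (Id_perm n) = n" by (simp add: Id_perm_def)
  have "{A. A \<subseteq> {..<length \<sigma>} \<and> card A = n \<and> pattern_at \<sigma> A = Id_perm n} =
      {A. A \<subseteq> {..<length \<sigma>} \<and> card A = n \<and> (\<forall>D\<in>set ` set runs. card (set (nths \<sigma> A) \<inter> D) \<le> 1)}"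
    using pattern_at_eq_Id[OF assms(1)] increasing_iff_transversal[OF assms(2)] by blast
  then show ?thesis
    unfolding pattern_density_def len
    using assms card_position_sets[OF assms(1), of n "\<lambda>V. \<forall>D\<in>set ` set runs. card (V \<inter> D) \<le> 1"] by simp
qed

text \<open>A nonempty set of values lies in at most one of the disjoint layers, so the decreasing
  patterns are counted layer by layer.\<close>

lemma pattern_density_Rev:
  assumes "distinct \<sigma>" "runs_of \<sigma> runs" "0 < n" "n \<le> length \<sigma>"
  shows "pattern_density (Rev_perm n) \<sigma> =
    (\<Sum>D\<in>set ` set runs. real (card D choose n)) / real (length \<sigma> choose n)"
proof -
  let ?D = "set ` set runs"
  have len: "length (Rev_perm n) = n" by (simp add: Rev_perm_def)
  have "pattern_at \<sigma> A = Rev_perm n \<longleftrightarrow> (\<exists>D\<in>?D. set (nths \<sigma> A) \<subseteq> D)"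
    if "A \<subseteq> {..<length \<sigma>}" "card A = n" for A
  proof -
    have "nths \<sigma> A \<noteq> []" 
      using length_nths_subset[OF that(1)] that(2) assms(3) by (metis less_irrefl list.size(3))
    then show ?thesis
      using pattern_at_eq_Rev[OF assms(1) that] decreasing_iff_monochromatic[OF assms(2)] by blast
  qed
  then have "{A. A \<subseteq> {..<length \<sigma>} \<and> card A = n \<and> pattern_at \<sigma> A = Rev_perm n} =
      {A. A \<subseteq> {..<length \<sigma>} \<and> card A = n \<and> (\<exists>D\<in>?D. set (nths \<sigma> A) \<subseteq> D)}"
    by blast
  then have "card {A. A \<subseteq> {..<length \<sigma>} \<and> card A = n \<and> pattern_at \<sigma> A = Rev_perm n}
      = card {V. V \<subseteq> set \<sigma> \<and> card V = n \<and> (\<exists>D\<in>?D. V \<subseteq> D)}"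
    using card_position_sets[OF assms(1), of n "\<lambda>V. \<exists>D\<in>?D. V \<subseteq> D"] by simp
  also have "{V. V \<subseteq> set \<sigma> \<and> card V = n \<and> (\<exists>D\<in>?D. V \<subseteq> D)} = (\<Union>D\<in>?D. {V. V \<subseteq> D \<and> card V = n})"
    using runs_of_partition(2)[OF assms(2)] by blast
  also have "card \<dots> = (\<Sum>D\<in>?D. card {V. V \<subseteq> D \<and> card V = n})"
  proof (rule card_UN_disjoint)
    show "\<forall>D\<in>?D. \<forall>E\<in>?D. D \<noteq> E \<longrightarrow> {V. V \<subseteq> D \<and> card V = n} \<inter> {V. V \<subseteq> E \<and> card V = n} = {}"
    proof (intro ballI impI)
      fix D E assume "D \<in> ?D" "E \<in> ?D" "D \<noteq> E"
      then have "D \<inter> E = {}"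
        using runs_of_partition(1)[OF assms(2)] by (auto simp: pairwise_def disjnt_def)
      then have "card V \<noteq> n" if "V \<subseteq> D" "V \<subseteq> E" for V
        using that assms(3) by (metis Int_greatest card.empty less_irrefl subset_empty)
      then show "{V. V \<subseteq> D \<and> card V = n} \<inter> {V. V \<subseteq> E \<and> card V = n} = {}"
        by blast
    qed
  qed auto
  also have "\<dots> = (\<Sum>D\<in>?D. card D choose n)"
    by (intro sum.cong refl) (auto intro!: n_subsets)
  finally show ?thesis using assms(4) by (simp add: pattern_density_def len)
qed

section \<open>Densities of layered permutations\<close>

text \<open>Both sides obey the same recursion when a block \<open>E\<close> is added: a transversal
  either avoids \<open>E\<close>, or it is one of the \<open>card E\<close> elements of
  \<open>E\<close> together with a transversal of the old blocks with one element less. Compare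
  \<open>esym_insert\<close>.\<close>

lemma card_transversals:
  fixes \<D> :: "'a set set"
  assumes "finite \<D>" "disjoint \<D>" "\<And>D. D \<in> \<D> \<Longrightarrow> finite D"
  shows "real (card {V. V \<subseteq> \<Union>\<D> \<and> card V = n \<and> (\<forall>D\<in>\<D>. card (V \<inter> D) \<le> 1)})
    = esym \<D> (\<lambda>D. real (card D)) n"
  using assms
proof (induction \<D> arbitrary: n rule: finite_induct)
  case empty
  have V: "{V :: 'a set. V \<subseteq> \<Union>{} \<and> card V = n \<and> (\<forall>D\<in>{}. card (V \<inter> D) \<le> 1)} = (if n = 0 then {{}} else {})"
    by auto
  have B: "{B :: 'a set set. B \<subseteq> {} \<and> card B = n} = (if n = 0 then {{}} else {})"
    by auto
  show ?case unfolding esym_def V B by simp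
next
  case (insert E \<D>)
  define T where "T n = {V. V \<subseteq> \<Union>\<D> \<and> card V = n \<and> (\<forall>D\<in>\<D>. card (V \<inter> D) \<le> 1)}" for n
  define T' where "T' n = {V. V \<subseteq> \<Union>(insert E \<D>) \<and> card V = n \<and> (\<forall>D\<in>insert E \<D>. card (V \<inter> D) \<le> 1)}" for n
  have disj: "E \<inter> D = {}" if "D \<in> \<D>" for D
  proof -
    have "E \<noteq> D" using insert.hyps(2) that by blast
    then have "disjnt E D" using pairwiseD[OF insert.prems(1), of E D] that by simp
    then show ?thesis by (simp add: disjnt_def)
  qed
  have finU: "finite (\<Union>\<D>)" and finE: "finite E"
    using insert by auto
  have disjU: "E \<inter> \<Union>\<D> = {}" using disj by blast
  have "disjoint \<D>" using insert.prems(1) by (simp add: pairwise_insert)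
  then have IH: "real (card (T n)) = esym \<D> (\<lambda>D. real (card D)) n" for n
    unfolding T_def using insert.IH insert.prems(2) by blast
  show ?case
  proof (cases n)
    case 0
    have "{V. V \<subseteq> \<Union>(insert E \<D>) \<and> card V = 0 \<and> (\<forall>D\<in>insert E \<D>. card (V \<inter> D) \<le> 1)} = {{}}"
      using finU finE by (auto simp: card_eq_0_iff dest: finite_subset)
    then show ?thesis using insert.hyps by (simp add: 0 esym_0 del: Union_insert)
  next
    case (Suc q)
    have "T' (Suc q) = T (Suc q) \<union> (\<lambda>(d, V). insert d V) ` (E \<times> T q)" (is "_ = ?R")
    proof (intro equalityI subsetI)
      fix V assume V: "V \<in> T' (Suc q)"
      have finV: "finite V" using V by (auto simp: T'_def intro: card_ge_0_finite)
      have "card (V \<inter> E) \<le> 1" using V by (simp add: T'_def)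
      then consider "V \<inter> E = {}" | d where "V \<inter> E = {d}"
        using finV by (metis card_0_eq card_1_singletonE finite_Int le_eq_less_or_eq less_one)
      then show "V \<in> ?R"
      proof cases
        case 1
        then have "V \<in> T (Suc q)" using V by (auto simp: T_def T'_def)
        then show ?thesis by blast
      next
        case 2
        then have d: "d \<in> V" "d \<in> E" by auto
        have "V - {d} \<in> T q"
        proof -
          have "V - {d} \<subseteq> \<Union>\<D>" using 2 V by (auto simp: T'_def)
          moreover have "card (V - {d}) = q" using V d finV by (simp add: T'_def)
          moreover have "card ((V - {d}) \<inter> D) \<le> 1" if "D \<in> \<D>" for D
          proof -
            have "(V - {d}) \<inter> D = V \<inter> D" using disj[OF that] d by blast
            then show ?thesis using V that by (simp add: T'_def)
          qed
          ultimately show ?thesis by (simp add: T_def)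
        qed
        then have "insert d (V - {d}) \<in> ?R" using d by (intro UnI2 image_eqI[of _ _ "(d, V - {d})"]) auto
        then show ?thesis using d by (simp add: insert_absorb)
      qed
    next
      fix V assume "V \<in> ?R"
      then show "V \<in> T' (Suc q)"
      proof
        assume V: "V \<in> T (Suc q)"
        then have "V \<inter> E = {}" using disjU by (auto simp: T_def)
        then show ?thesis using V by (auto simp: T_def T'_def)
      next
        assume "V \<in> (\<lambda>(d, V). insert d V) ` (E \<times> T q)"
        then obtain d W where W: "d \<in> E" "W \<in> T q" "V = insert d W" by auto
        then have sub: "W \<subseteq> \<Union>\<D>" by (simp add: T_def)
        then have WE: "W \<inter> E = {}" "finite W" using disjU finU by (auto dest: finite_subset)
        then have "d \<notin> W" using W by blast
        have "V \<inter> E = {d}" using WE W by blast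
        moreover have "V \<inter> D = W \<inter> D" if "D \<in> \<D>" for D using disj[OF that] W by blast
        ultimately show ?thesis
          using W sub WE \<open>d \<notin> W\<close> by (auto simp: T_def T'_def)
      qed
    qed
    moreover have "card (T (Suc q) \<union> (\<lambda>(d, V). insert d V) ` (E \<times> T q)) = card (T (Suc q)) + card E * card (T q)"
    proof -
      have fin: "finite (T m)" for m
        by (rule finite_subset[of _ "Pow (\<Union>\<D>)"]) (use finU in \<open>auto simp: T_def\<close>)
      have sub: "V \<inter> E = {}" if "V \<in> T m" for V m using that disjU by (auto simp: T_def)
      \<comment> \<open>From \<open>insert d V\<close> the element \<open>d\<close> is recovered by
        intersecting with \<open>E\<close>, and \<open>V\<close> by removing
        \<open>E\<close>.\<close>
      have "inj_on (\<lambda>(d, V). insert d V) (E \<times> T q)"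
      proof (rule inj_onI, clarify)
        fix d V d' V' assume *: "d \<in> E" "V \<in> T q" "d' \<in> E" "V' \<in> T q" "insert d V = insert d' V'"
        have "insert d V \<inter> E = {d}" "insert d' V' \<inter> E = {d'}" "insert d V - E = V" "insert d' V' - E = V'"
          using * sub by blast+
        then show "d = d' \<and> V = V'" using *(5) by (metis singleton_inject)
      qed
      then have "card ((\<lambda>(d, V). insert d V) ` (E \<times> T q)) = card E * card (T q)"
        by (simp add: card_image card_cartesian_product)
      moreover have "T (Suc q) \<inter> (\<lambda>(d, V). insert d V) ` (E \<times> T q) = {}"
      proof -
        have "d \<notin> E" if "insert d V \<in> T (Suc q)" for d V using sub[OF that] by blast
        then show ?thesis by fastforce
      qed
      ultimately show ?thesis using fin finE by (subst card_Un_disjoint) auto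
    qed
    ultimately have "real (card (T' (Suc q))) = esym \<D> (\<lambda>D. real (card D)) (Suc q) + real (card E) * esym \<D> (\<lambda>D. real (card D)) q"
      by (simp add: IH)
    then show ?thesis using insert.hyps by (simp add: T'_def Suc esym_insert)
  qed
qed

section \<open>Binomial coefficients compared with powers\<close>

lemma fact_times_binomial_le: "fact k * real (n choose k) \<le> real n ^ k"
  using binomial_fact_pow[of n k]
  by (metis mult.commute of_nat_fact of_nat_le_iff of_nat_mult of_nat_power)

lemma fact_times_binomial_eq_prod: "fact k * real (n choose k) = (\<Prod>i<k. real n - real i)"
  by (simp add: binomial_gbinomial gbinomial_prod_rev atLeast0LessThan)

text \<open>Each new factor \<open>n - i\<close> of the falling factorial loses at most
  \<open>i * n ^ (k - 1)\<close> in the leading order; \<open>k * k\<close> is a generous bound for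
  the total. No relation between \<open>n\<close> and \<open>k\<close> is assumed, so small layers
  are covered.\<close>

lemma fact_times_binomial_ge:
  assumes "k > 0"
  shows "real n ^ k - real (k * k) * real n ^ (k - 1) \<le> fact k * real (n choose k)"
proof -
  have "real n ^ Suc k - real (Suc k * Suc k) * real n ^ k \<le> fact (Suc k) * real (n choose Suc k)" for k
  proof (induction k)
    case (Suc k)
    define f where "f = fact (Suc k) * real (n choose Suc k)"
    have f: "f \<le> real n ^ Suc k" unfolding f_def by (rule fact_times_binomial_le)
    have "real n ^ Suc (Suc k) - real (Suc (Suc k) * Suc (Suc k)) * real n ^ Suc k
        \<le> real n * (real n ^ Suc k - real (Suc k * Suc k) * real n ^ k) - real (Suc k) * real n ^ Suc k"
      by (simp add: algebra_simps)
    \<comment> \<open>The factor \<open>n - Suc k\<close> may be negative, so the two products are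
      estimated separately: \<open>f\<close> from below in the first, from above in the
      second.\<close>
    also have "\<dots> \<le> real n * f - real (Suc k) * f"
      using Suc f unfolding f_def[symmetric] by (intro diff_mono mult_left_mono) auto
    also have "\<dots> = fact (Suc (Suc k)) * real (n choose Suc (Suc k))"
      unfolding f_def fact_times_binomial_eq_prod by (simp add: algebra_simps)
    finally show ?case .
  qed simp
  from this[of "k - 1"] show ?thesis using assms by simp
qed

text \<open>Factor by factor, \<open>(q - i) / (n - i) \<le> q / n\<close> because
  \<open>q \<le> n\<close>. If \<open>k\<close> exceeds \<open>q\<close>, the left side is
  0.\<close>

lemma binomial_ratio_le:
  assumes "q \<le> n" "k \<le> n"
  shows "real (q choose k) / real (n choose k) \<le> (real q / real n) ^ k"
proof (cases "k \<le> q")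
  case True
  have "real (q choose k) / real (n choose k) = (fact k * real (q choose k)) / (fact k * real (n choose k))"
    by simp
  also have "\<dots> = (\<Prod>i<k. (real q - real i) / (real n - real i))"
    unfolding fact_times_binomial_eq_prod by (simp add: prod_dividef)
  also have "\<dots> \<le> (\<Prod>i<k. real q / real n)"
  proof (rule prod_mono)
    fix i assume "i \<in> {..<k}"
    then have i: "i < q" "i < n" using True assms by auto
    have "real i * real q \<le> real i * real n" using assms by (intro mult_left_mono) auto
    then have "(real q - real i) * real n \<le> real q * (real n - real i)" by (simp add: algebra_simps)
    then show "0 \<le> (real q - real i) / (real n - real i) \<and> (real q - real i) / (real n - real i) \<le> real q / real n"
      using i by (simp add: divide_simps)
  qed
  finally show ?thesis by simp
qed (simp add: binomial_eq_0)

section \<open>Lower bound for every layered permutation\<close>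

lemma layered_density_ge:
  assumes "3 \<le> l" "l \<le> k" "k \<le> N" "\<sigma> \<in> permutations_of_set {1..N}" "layered \<sigma>"
  shows "1 / (real l - 1) ^ (k - 1) - real (k * k) / real N
    \<le> pattern_density (Id_perm l) \<sigma> + pattern_density (Rev_perm k) \<sigma>"
proof -
  have \<sigma>: "set \<sigma> = {1..N}" "distinct \<sigma>" "length \<sigma> = N"
    using assms(4) perm_nth_bij(1) by (auto simp: permutations_of_set_def)
  obtain runs where runs: "runs_of \<sigma> runs" using layered_runs[OF assms(5)] .
  define \<D> where "\<D> = set ` set runs"
  define x where "x D = real (card D) / real N" for D :: "nat set"
  have N: "N > 0" using assms by simp
  have \<D>: "finite \<D>" "disjoint \<D>" "\<Union>\<D> = {1..N}" "\<And>D. D \<in> \<D> \<Longrightarrow> finite D"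
    using runs_of_partition[OF runs] \<sigma> by (auto simp: \<D>_def)
  have sum_card: "(\<Sum>D\<in>\<D>. real (card D)) = real N"
  proof -
    have "card (\<Union>\<D>) = (\<Sum>D\<in>\<D>. card D)"
      using \<D> by (intro card_Union_disjoint) auto
    then show ?thesis using \<D>(3) by (simp flip: of_nat_sum)
  qed
  have le_N: "card D \<le> N" if "D \<in> \<D>" for D
    using card_mono[of "{1..N}" D] \<D>(3) that by auto
  have "pattern_density (Id_perm l) \<sigma> = esym \<D> (\<lambda>D. real (card D)) l / real (N choose l)"
    using pattern_density_Id[OF \<sigma>(2) runs, of l] card_transversals[OF \<D>(1,2,4), of l] assms \<D>(3) \<sigma>
    unfolding \<D>_def[symmetric] by simp
  also have "\<dots> = fact l * esym \<D> (\<lambda>D. real (card D)) l / (fact l * real (N choose l))"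
    by simp
  also have "\<dots> \<ge> fact l * esym \<D> (\<lambda>D. real (card D)) l / real N ^ l"
    using fact_times_binomial_le[of l N] assms
    by (intro divide_left_mono mult_nonneg_nonneg esym_nonneg) auto
  finally have Id: "fact l * esym \<D> x l \<le> pattern_density (Id_perm l) \<sigma>"
    unfolding x_def esym_divide by simp
  have "(\<Sum>D\<in>\<D>. x D ^ k) - real (k * k) / real N
      \<le> (\<Sum>D\<in>\<D>. fact k * real (card D choose k)) / real N ^ k"
  proof -
    \<comment> \<open>Bounding all but one factor by \<open>N\<close> and summing the remaining
      layer sizes to \<open>N\<close> makes the total error \<open>k * k / N\<close>, independent of
      the number of layers.\<close>
    have "(\<Sum>D\<in>\<D>. real (card D) ^ (k - 1)) \<le> (\<Sum>D\<in>\<D>. real (card D) * real N ^ (k - 2))"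
    proof (rule sum_mono)
      fix D assume "D \<in> \<D>"
      have "real (card D) ^ (k - 1) = real (card D) * real (card D) ^ (k - 2)"
        using assms by (simp flip: power_Suc add: Suc_diff_Suc numeral_2_eq_2)
      also have "\<dots> \<le> real (card D) * real N ^ (k - 2)"
        using le_N[OF \<open>D \<in> \<D>\<close>] by (intro mult_left_mono power_mono) auto
      finally show "real (card D) ^ (k - 1) \<le> real (card D) * real N ^ (k - 2)" .
    qed
    also have "\<dots> = real N ^ (k - 1)"
      unfolding sum_distrib_right[symmetric] sum_card
      using assms by (simp flip: power_Suc add: Suc_diff_Suc numeral_2_eq_2)
    finally have "real (k * k) * (\<Sum>D\<in>\<D>. real (card D) ^ (k - 1)) \<le> real (k * k) * real N ^ (k - 1)"
      by (intro mult_left_mono) auto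
    moreover have "(\<Sum>D\<in>\<D>. real (card D) ^ k) - real (k * k) * (\<Sum>D\<in>\<D>. real (card D) ^ (k - 1))
        \<le> (\<Sum>D\<in>\<D>. fact k * real (card D choose k))"
      unfolding sum_distrib_left sum_subtractf[symmetric]
      using assms by (intro sum_mono fact_times_binomial_ge) auto
    ultimately have "((\<Sum>D\<in>\<D>. real (card D) ^ k) - real (k * k) * real N ^ (k - 1)) / real N ^ k
        \<le> (\<Sum>D\<in>\<D>. fact k * real (card D choose k)) / real N ^ k"
      by (intro divide_right_mono) auto
    moreover have "real N ^ k = real N * real N ^ (k - 1)" using assms by (simp flip: power_Suc)
    ultimately show ?thesis
      using N by (simp add: x_def power_divide diff_divide_distrib flip: sum_divide_distrib)
  qed
  also have "\<dots> \<le> (\<Sum>D\<in>\<D>. fact k * real (card D choose k)) / (fact k * real (N choose k))"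
    using fact_times_binomial_le[of k N] assms
    by (intro divide_left_mono sum_nonneg) auto
  also have "\<dots> = pattern_density (Rev_perm k) \<sigma>"
    using pattern_density_Rev[OF \<sigma>(2) runs, of k] assms \<sigma>
    unfolding \<D>_def[symmetric] sum_distrib_left[symmetric] by simp
  finally have Rev: "(\<Sum>D\<in>\<D>. x D ^ k) - real (k * k) / real N \<le> pattern_density (Rev_perm k) \<sigma>" .
  have "sum x \<D> = 1" using sum_card N by (simp add: x_def flip: sum_divide_distrib)
  then have "1 / (real l - 1) ^ (k - 1) \<le> fact l * esym \<D> x l + (\<Sum>D\<in>\<D>. x D ^ k)"
    using assms \<D> by (intro esym_power_sum_ge) (auto simp: x_def)
  then show ?thesis using Id Rev by linarith
qed

section \<open>Layered permutations with few layers of bounded size\<close>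

lemma ex_balanced_runs:
  assumes "N \<le> m * q"
  shows "\<exists>runs. concat runs \<in> permutations_of_set {1..N} \<and>
     (\<forall>r\<in>set runs. \<exists>a b. a < b \<and> r = rev [a..<b]) \<and>
     sorted_wrt (\<lambda>r s. \<forall>x\<in>set r. \<forall>y\<in>set s. x < y) runs \<and>
     length runs \<le> m \<and> (\<forall>r\<in>set runs. length r \<le> q)"
  using assms
proof (induction m arbitrary: N)
  case 0
  then show ?case by (intro exI[of _ "[]"]) simp
next
  case (Suc m)
  show ?case
  proof (cases "N = 0")
    case True
    then show ?thesis by (intro exI[of _ "[]"]) simp
  next
    case False
    then have q: "q > 0" using Suc.prems by (cases q) auto
    \<comment> \<open>The largest \<open>q\<close> values form the last run. Truncated subtraction
      gives \<open>M = 0\<close> when fewer than \<open>q\<close> values are left, so that run then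
      takes them all.\<close>
    define M where "M = N - q"
    have M: "M < N" "M \<le> m * q" "N \<le> M + q"
      using q False Suc.prems by (auto simp: M_def)
    obtain runs where runs: "concat runs \<in> permutations_of_set {1..M}"
        "\<forall>r\<in>set runs. \<exists>a b. a < b \<and> r = rev [a..<b]"
        "sorted_wrt (\<lambda>r s. \<forall>x\<in>set r. \<forall>y\<in>set s. x < y) runs"
        "length runs \<le> m" "\<forall>r\<in>set runs. length r \<le> q"
      using Suc.IH[OF M(2)] by blast
    define r where "r = rev [Suc M..<Suc N]"
    have set_r: "set r = {Suc M..N}" by (auto simp: r_def simp del: upt_Suc)
    have "concat (runs @ [r]) \<in> permutations_of_set {1..N}"
    proof -
      have "set (concat (runs @ [r])) = {1..M} \<union> {Suc M..N}"
        using runs(1) set_r by (simp add: permutations_of_set_def)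
      also have "\<dots> = {1..N}" using M by auto
      finally have "set (concat (runs @ [r])) = {1..N}" .
      moreover have "distinct (concat (runs @ [r]))"
      proof -
        have "distinct r" by (simp add: r_def del: upt_Suc)
        moreover have "set (concat runs) = {1..M}" "distinct (concat runs)"
          using runs(1) by (auto simp: permutations_of_set_def)
        ultimately show ?thesis by (auto simp: set_r simp del: set_concat)
      qed
      ultimately show ?thesis by (simp add: permutations_of_set_def)
    qed
    moreover have "\<forall>s\<in>set (runs @ [r]). \<exists>a b. a < b \<and> s = rev [a..<b]"
      using runs(2) M(1) by (auto simp: r_def simp del: upt_Suc)
    moreover have "sorted_wrt (\<lambda>r s. \<forall>x\<in>set r. \<forall>y\<in>set s. x < y) (runs @ [r])"
    proof -
      have "\<Union>(set ` set runs) = {1..M}" using runs(1) by (simp add: permutations_of_set_def)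
      then have "x \<le> M" if "s \<in> set runs" "x \<in> set s" for s x using that by auto
      then show ?thesis using runs(3) by (fastforce simp: sorted_wrt_append set_r)
    qed
    moreover have "length (runs @ [r]) \<le> Suc m" using runs(4) by simp
    moreover have "\<forall>s\<in>set (runs @ [r]). length s \<le> q"
      using runs(5) M by (auto simp: r_def simp del: upt_Suc)
    ultimately show ?thesis by blast
  qed
qed

text \<open>With at most \<open>m < l\<close> layers there is no increasing pattern of length
  \<open>l\<close>, so only the decreasing patterns count, and each layer of size at most
  \<open>q\<close> contributes at most \<open>(q / N) ^ k\<close>.\<close>

lemma ex_layered_density_le:
  assumes "0 < m" "m < l" "0 < k" "l \<le> N" "k \<le> N" "N \<le> m * q" "q \<le> N"
  shows "\<exists>\<sigma>\<in>permutations_of_set {1..N}. layered \<sigma> \<and>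
    pattern_density (Id_perm l) \<sigma> + pattern_density (Rev_perm k) \<sigma> \<le> real m * (real q / real N) ^ k"
proof -
  obtain runs where runs: "concat runs \<in> permutations_of_set {1..N}"
        "\<forall>r\<in>set runs. \<exists>a b. a < b \<and> r = rev [a..<b]"
        "sorted_wrt (\<lambda>r s. \<forall>x\<in>set r. \<forall>y\<in>set s. x < y) runs"
        "length runs \<le> m" "\<forall>r\<in>set runs. length r \<le> q"
    using ex_balanced_runs[OF assms(6)] by blast
  define \<sigma> where "\<sigma> = concat runs"
  define \<D> where "\<D> = set ` set runs"
  have \<sigma>: "set \<sigma> = {1..N}" "distinct \<sigma>" "length \<sigma> = N"
    using runs(1) perm_nth_bij(1) by (auto simp: permutations_of_set_def \<sigma>_def)
  have layered: "layered \<sigma>" unfolding layered_def \<sigma>_def using runs(2,3) by blast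
  have runs': "runs_of \<sigma> runs"
    unfolding runs_of_def \<sigma>_def using runs(2,3) by (fastforce simp: sorted_wrt_rev)
  have \<D>: "finite \<D>" "disjoint \<D>" "\<Union>\<D> = {1..N}" "\<And>D. D \<in> \<D> \<Longrightarrow> finite D"
    using runs_of_partition[OF runs'] \<sigma> by (auto simp: \<D>_def)
  have card_\<D>: "card \<D> \<le> m"
    unfolding \<D>_def using runs(4) card_length[of runs] card_image_le[of "set runs" set] by simp
  have le_q: "card D \<le> q" if "D \<in> \<D>" for D
    using that runs(5) card_length order_trans unfolding \<D>_def by blast
  have "esym \<D> (\<lambda>D. real (card D)) l = 0"
  proof -
    have "card B < l" if "B \<subseteq> \<D>" for B
      using card_mono[OF \<D>(1) that] card_\<D> assms(2) by linarith
    then have "{B. B \<subseteq> \<D> \<and> card B = l} = {}" by blast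
    then show ?thesis by (simp only: esym_def sum.empty)
  qed
  then have "pattern_density (Id_perm l) \<sigma> = 0"
    using pattern_density_Id[OF \<sigma>(2) runs', of l] card_transversals[OF \<D>(1,2,4), of l] assms \<D>(3) \<sigma>
    unfolding \<D>_def[symmetric] by simp
  moreover have "pattern_density (Rev_perm k) \<sigma> \<le> real m * (real q / real N) ^ k"
  proof -
    have "pattern_density (Rev_perm k) \<sigma> = (\<Sum>D\<in>\<D>. real (card D choose k) / real (N choose k))"
      using pattern_density_Rev[OF \<sigma>(2) runs', of k] assms \<sigma>
      unfolding \<D>_def[symmetric] by (simp add: sum_divide_distrib)
    also have "\<dots> \<le> real (card \<D>) * (real q / real N) ^ k"
    proof (rule sum_bounded_above)
      fix D assume D: "D \<in> \<D>"
      have "real (card D choose k) / real (N choose k) \<le> (real (card D) / real N) ^ k"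
        using le_q[OF D] assms by (intro binomial_ratio_le) auto
      also have "\<dots> \<le> (real q / real N) ^ k"
        using le_q[OF D] by (intro power_mono divide_right_mono) auto
      finally show "real (card D choose k) / real (N choose k) \<le> (real q / real N) ^ k" .
    qed
    also have "\<dots> \<le> real m * (real q / real N) ^ k"
      using card_\<D> by (intro mult_right_mono) auto
    finally show ?thesis .
  qed
  ultimately show ?thesis using layered runs(1) by (intro bexI[of _ \<sigma>]) (auto simp: \<sigma>_def)
qed

section \<open>Passage to the limit\<close>

lemma comb_density_formal_perm_add:
  assumes "\<tau> \<noteq> \<rho>"
  shows "comb_density (formal_perm \<tau> + formal_perm \<rho>) \<sigma> = pattern_density \<tau> \<sigma> + pattern_density \<rho> \<sigma>"
proof -
  have "Poly_Mapping.lookup (formal_perm \<tau> + formal_perm \<rho>) v = (if v = \<tau> \<or> v = \<rho> then 1 else 0)" for v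
    using assms by (auto simp: formal_perm_def lookup_add lookup_single when_def)
  moreover from this have "Poly_Mapping.keys (formal_perm \<tau> + formal_perm \<rho>) = {\<tau>, \<rho>}"
    by (auto simp: in_keys_iff split: if_splits)
  ultimately show ?thesis using assms by (simp add: comb_density_def)
qed

lemma Id_perm_neq_Rev_perm:
  assumes "2 \<le> l"
  shows "Id_perm l \<noteq> Rev_perm k"
proof
  assume eq: "Id_perm l = Rev_perm k"
  then have "length (Id_perm l) = length (Rev_perm k)" by simp
  then have "l = k" by (simp add: Id_perm_def Rev_perm_def del: upt_Suc)
  then have "Id_perm l ! 0 = Rev_perm l ! 0" using eq by simp
  then show False using assms by (simp add: Id_perm_def Rev_perm_def rev_nth del: upt_Suc)
qed

lemma layered_min_tendsto:
  assumes "3 \<le> l" "l \<le> k"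
  shows "layered_min (formal_perm (Id_perm l) + formal_perm (Rev_perm k))
    \<longlonglongrightarrow> 1 / (real l - 1) ^ (k - 1)" (is "layered_min ?f \<longlonglongrightarrow> ?c")
proof -
  define m where "m = l - 1"
  have m: "2 \<le> m" "m < l" "real l - 1 = real m" using assms by (auto simp: m_def)
  have comb: "comb_density ?f \<sigma> = pattern_density (Id_perm l) \<sigma> + pattern_density (Rev_perm k) \<sigma>" for \<sigma>
    using assms by (intro comb_density_formal_perm_add Id_perm_neq_Rev_perm) auto
  define S where "S N = {comb_density ?f \<sigma> |\<sigma>. \<sigma> \<in> permutations_of_set {1..N} \<and> layered \<sigma>}" for N
  have fin: "finite (S N)" for N unfolding S_def by (rule finite_image_set) simp
  \<comment> \<open>Upper bound obtained from layers of size at most \<open>q\<close>, since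
    \<open>q / N \<le> 1 / m + 1 / N\<close> for the \<open>q\<close> chosen below.\<close>
  define U where "U N = real m * (1 / real m + 1 / real N) ^ k" for N
  have bounds: "?c - real (k * k) / real N \<le> layered_min ?f N \<and> layered_min ?f N \<le> U N"
    if kN: "k \<le> N" for N
  proof -
    \<comment> \<open>Adding 1 ensures that \<open>m\<close> layers of size \<open>q\<close> cover
      all \<open>N\<close> values even if \<open>m\<close> does not divide \<open>N\<close>.\<close>
    define q where "q = N div m + 1"
    have N: "N \<ge> 3" "N > 0" using that assms by auto
    have "N div m \<le> N div 2" using m by (intro div_le_mono2) auto
    then have q: "q \<le> N" using N unfolding q_def by linarith
    have "N = m * (N div m) + N mod m" by simp
    moreover have "N mod m < m" using m by simp
    ultimately have "N \<le> m * q" unfolding q_def distrib_left by linarith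
    moreover have "0 < m" "0 < k" "l \<le> N" using m assms that by auto
    ultimately obtain \<sigma> where \<sigma>: "\<sigma> \<in> permutations_of_set {1..N}" "layered \<sigma>"
        "comb_density ?f \<sigma> \<le> real m * (real q / real N) ^ k"
      using ex_layered_density_le[of m l k N q] q m(2) kN unfolding comb by blast
    then have mem: "comb_density ?f \<sigma> \<in> S N" by (auto simp: S_def)
    have "?c - real (k * k) / real N \<le> Min (S N)"
    proof (rule Min.boundedI[OF fin])
      \<comment> \<open>The witness for the upper bound also guarantees that the minimum is over a
        nonempty set.\<close>
      show "S N \<noteq> {}" using mem by blast
      fix d assume "d \<in> S N"
      then show "?c - real (k * k) / real N \<le> d"
        using layered_density_ge[OF assms kN] by (auto simp: S_def comb)
    qed
    moreover have "Min (S N) \<le> comb_density ?f \<sigma>" by (rule Min_le[OF fin mem])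
    moreover have "real m * (real q / real N) ^ k \<le> U N"
    proof -
      have "real q \<le> real N / real m + 1" unfolding q_def using of_nat_div_le_of_nat[of N m, where ?'a = real] by simp
      then have "real q / real N \<le> (real N / real m + 1) / real N" by (intro divide_right_mono) auto
      also have "\<dots> = 1 / real m + 1 / real N" using N m by (simp add: field_simps)
      finally show ?thesis unfolding U_def by (intro mult_left_mono power_mono) auto
    qed
    ultimately show ?thesis using \<sigma>(3) by (auto simp: layered_min_def S_def)
  qed
  have "(\<lambda>N. ?c - real (k * k) / real N) \<longlonglongrightarrow> ?c - 0"
    by (intro tendsto_diff tendsto_const lim_const_over_n)
  then have lower: "(\<lambda>N. ?c - real (k * k) / real N) \<longlonglongrightarrow> ?c" by simp
  have "U \<longlonglongrightarrow> real m * (1 / real m + 0) ^ k"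
    unfolding U_def by (intro tendsto_intros lim_const_over_n)
  moreover have "real m * (1 / real m + 0) ^ k = ?c"
  proof -
    have "real m ^ k = real m * real m ^ (k - 1)"
      using assms by (simp flip: power_Suc)
    then show ?thesis using m(1) unfolding m(3) by (simp add: power_divide)
  qed
  ultimately have upper: "U \<longlonglongrightarrow> ?c" by simp
  show ?thesis
    by (rule tendsto_sandwich[OF _ _ lower upper])
      (use bounds in \<open>auto intro!: eventually_sequentiallyI[of k]\<close>)
qed

theorem mainTheorem2:
  shows "(\<forall>k l :: nat. k \<ge> l \<and> l \<ge> 3 \<longrightarrow>
            convergent (layered_min (formal_perm (Id_perm l) + formal_perm (Rev_perm k))) \<and>
            layered_limit (formal_perm (Id_perm l) + formal_perm (Rev_perm k))
              = 1 / (real l - 1) ^ (k - 1))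
       \<and> (\<forall>m :: nat. m \<ge> 2 \<longrightarrow>
            convergent (layered_min (formal_perm (Id_perm (m + 1)) + formal_perm (Rev_perm (m + 1)))) \<and>
            layered_limit (formal_perm (Id_perm (m + 1)) + formal_perm (Rev_perm (m + 1)))
              = 1 / real m ^ m)"
proof -
  \<comment> \<open>Convergence is carried along with the value, because \<open>lim\<close> is
    informative only for convergent sequences.\<close>
  have main: "convergent (layered_min (formal_perm (Id_perm l) + formal_perm (Rev_perm k))) \<and>
      layered_limit (formal_perm (Id_perm l) + formal_perm (Rev_perm k)) = 1 / (real l - 1) ^ (k - 1)"
    if "k \<ge> l" "l \<ge> 3" for k l
    using layered_min_tendsto[OF that(2,1)] unfolding layered_limit_def
    by (blast intro: convergentI limI)
  have "convergent (layered_min (formal_perm (Id_perm (m + 1)) + formal_perm (Rev_perm (m + 1)))) \<and>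
      layered_limit (formal_perm (Id_perm (m + 1)) + formal_perm (Rev_perm (m + 1))) = 1 / real m ^ m"
    if "m \<ge> 2" for m
    using main[of "m + 1" "m + 1"] that by simp
  with main show ?thesis by blast
qed

end
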